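(* For any positive integer $n$ there is an effectively computable number $\tau$ such that the following holds. If $q\ge 3$, $D\subset F_q^*$, $1\not\in D$, and $\mathcal B$ is a system modulo $q$ such that for each $a\in D$ the set $z(a,1)$ is nonempty, and the set $\bigcup_{a\in D}z(a,1)$ consists of numbers with imaginary part $\ge\tau$ and contains at most $n$ elements, then $\mathcal B$ is a barrier for the following statement about a family $\mathcal F=(F_{q,a})_{a\in F_q^*}$: for all sufficiently large $x$ there exists $a\in D$ such that $$F_{q,1}(x)\le \frac{F_{q,a}(x)+F_{q,a^{-1}}(x)}{2}.$$
   Context: Let $q\ge 3$ be an integer, $F_q^*$ the multiplicative group of reduced residues modulo $q$ (inverses $a^{-1}$ are taken in it), $\phi$ Euler's function, $C_q$ the set of non-principal Dirichlet characters modulo $q$, $\pi(x)$ the number of primes $\le x$. For complex $\rho$ with $\Re\rho>0$ and $x\ge 2$ put $$f(\rho)=\frac{x^{\rho}}{\rho\log x}+\frac1\rho\int_2^x\frac{t^\rho}{t\log^2 t}\,dt .$$ A system $\mathcal B$ (modulo $q$) assigns to each $\chi\in C_q$ a sequence $B(\chi)$ (possibly empty, repetitions allowed) of complex numbers with non-negative imaginary part; $n(\rho,\chi)$ is the number of occurrences of $\rho$ in $B(\chi)$ (0 if it does not occur). If $\rho$ is real it is required that $n(\rho,\chi)=n(\rho,\overline\chi)$. Put $R^+(\mathcal B)=\sup\{\Re\rho:\rho\in\mathcal B\}$, $R^-(\mathcal B)=\inf\{\Re\rho:\rho\in\mathcal B\}$. It is always assumed that $\frac12<R^-(\mathcal B)\le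 R^+(\mathcal B)\le 1$ and $\sum_{\chi\in C_q}\sum_{\rho\in B(\chi)} n(\rho,\chi)/|\rho|<\infty$ (sums are over distinct $\rho$). Define $$P_{q,a}(x;\mathcal B)=-\frac{2}{\phi(q)}\Re\Big(\sum_{\chi\in C_q}\overline\chi(a)\sum_{\rho\in B(\chi)}w(\rho)\,n(\rho,\chi) f(\rho)\Big)+\frac{\pi(x)}{\phi(q)},$$ where the inner sum is over distinct $\rho$, $w(\rho)=\frac12$ if $\rho$ is real and $w(\rho)=1$ otherwise. A family $\mathcal F=(F_{q,a})_{a\in F_q^*}$ of functions $[0,\infty)\to\mathbb R$ is $\beta$-similar to $\mathcal P_q=(P_{q,a}(\cdot;\mathcal B))_{a\in F_q^*}$ if $|F_{q,a}(x)-P_{q,a}(x;\mathcal B)|=o(x^\beta/\log x)$ as $x\to\infty$ for every $a$. For a statement $\mathcal I(\mathcal F)$ about such families, $\mathcal B$ is a barrier for $\mathcal I$ if, with $\beta=R^-(\mathcal B)$, for every $\mathcal F$ that is $\beta$-similar to $\mathcal P_q$ the statement $\mathcal I(\mathcal F)$ is false. For $a,b\in F_q^*$ let $g(\rho;a,b)=\sum_{\chi\in C_q}n(\rho,\chi)(\chi(a)-\chi(b))$, $\beta(a,b)=\sup\{\Re\rho: g(\rho;a,b)\ne0\}$, and $z(a,b)=\bigcup_{\chi\in C_q}\{\rho\in B(\chi): g(\rho;a,b)\ne 0,\ \Re\rho=\beta(a,b)\}$. *)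

theory Defs
  imports
    "HOL-Analysis.Analysis"
    "HOL-Library.Landau_Symbols"
    "HOL-Number_Theory.Number_Theory"
begin

text \<open>
  Total recursive functions of \<open>k\<close> natural-number arguments, passed as a list of length \<open>k\<close>
  (values on lists of any other length are irrelevant). Minimisation is restricted to regular
  functions, so that every function obtained is total.
\<close>

inductive recursive_fn :: "nat \<Rightarrow> (nat list \<Rightarrow> nat) \<Rightarrow> bool" where
  zero: "recursive_fn k (\<lambda>_. 0)"
| succ: "recursive_fn 1 (\<lambda>xs. Suc (xs ! 0))"
| proj: "i < k \<Longrightarrow> recursive_fn k (\<lambda>xs. xs ! i)"
| comp: "recursive_fn (length gs) f \<Longrightarrow> (\<forall>g\<in>set gs. recursive_fn k g) \<Longrightarrow>
    recursive_fn k (\<lambda>xs. f (map (\<lambda>g. g xs) gs))"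
| prim_rec: "recursive_fn k f \<Longrightarrow> recursive_fn (Suc (Suc k)) g \<Longrightarrow>
    recursive_fn (Suc k)
      (\<lambda>xs. rec_nat (f (tl xs)) (\<lambda>y r. g (y # r # tl xs)) (hd xs))"
| minim: "recursive_fn (Suc k) f \<Longrightarrow> (\<forall>xs. length xs = k \<longrightarrow> (\<exists>y. f (y # xs) = 0)) \<Longrightarrow>
    recursive_fn k (\<lambda>xs. LEAST y. f (y # xs) = 0)"

text \<open>
  A computable sequence of reals: from \<open>n\<close> and \<open>k\<close> one can compute a rational number
  (as a difference of two naturals divided by \<open>k + 1\<close>) within \<open>1 / (k + 1)\<close> of \<open>\<tau> n\<close>.
\<close>

definition computable_real_seq :: "(nat \<Rightarrow> real) \<Rightarrow> bool" where
  "computable_real_seq \<tau> \<longleftrightarrow>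
     (\<exists>f g. recursive_fn 2 f \<and> recursive_fn 2 g \<and>
       (\<forall>n k. \<bar>\<tau> n - (real (f [n, k]) - real (g [n, k])) / real (k + 1)\<bar> \<le> 1 / real (k + 1)))"

definition unit_grp :: "nat \<Rightarrow> int monoid" where
  "unit_grp q = units_of (residue_ring (int q))"

definition dirichlet_character :: "nat \<Rightarrow> (int \<Rightarrow> complex) \<Rightarrow> bool" where
  "dirichlet_character q \<psi> \<longleftrightarrow>
     (\<forall>m n. \<psi> (m * n) = \<psi> m * \<psi> n) \<and>
     (\<forall>m. \<psi> (m + int q) = \<psi> m) \<and>
     (\<forall>m. \<psi> m \<noteq> 0 \<longleftrightarrow> coprime m (int q))"

definition principal_character :: "nat \<Rightarrow> int \<Rightarrow> complex" where
  "principal_character q m = (if coprime m (int q) then 1 else 0)"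

definition nonprincipal_characters :: "nat \<Rightarrow> (int \<Rightarrow> complex) set" where
  "nonprincipal_characters q = {\<psi>. dirichlet_character q \<psi>} - {principal_character q}"

definition cnj_character :: "(int \<Rightarrow> complex) \<Rightarrow> int \<Rightarrow> complex" where
  "cnj_character \<psi> m = cnj (\<psi> m)"

definition prime_count :: "real \<Rightarrow> nat" where
  "prime_count x = card {p::nat. prime p \<and> real p \<le> x}"

definition f_rho :: "complex \<Rightarrow> real \<Rightarrow> complex" where
  "f_rho \<rho> x =
     of_real x powr \<rho> / (\<rho> * of_real (ln x)) +
     1 / \<rho> * integral {2..x} (\<lambda>t. of_real t powr \<rho> / of_real (t * (ln t)\<^sup>2))"

text \<open>
  Characters are written \<open>\<psi>\<close>, since chi is a binder in HOL-Analysis.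
  A finite or infinite sequence is a partial function on the naturals; once it takes the value
  \<open>None\<close> it has ended (this is required in \<open>is_system\<close>). Only the values at characters in
  \<open>nonprincipal_characters q\<close> matter.
\<close>

type_synonym zero_system = "(int \<Rightarrow> complex) \<Rightarrow> nat \<Rightarrow> complex option"

definition elems :: "zero_system \<Rightarrow> (int \<Rightarrow> complex) \<Rightarrow> complex set" where
  "elems B \<psi> = {\<rho>. \<exists>k. B \<psi> k = Some \<rho>}"

definition multip :: "zero_system \<Rightarrow> complex \<Rightarrow> (int \<Rightarrow> complex) \<Rightarrow> nat" where
  "multip B \<rho> \<psi> = card {k. B \<psi> k = Some \<rho>}"

definition R_plus :: "nat \<Rightarrow> zero_system \<Rightarrow> ereal" where
  "R_plus q B = (SUP \<rho>\<in>(\<Union>\<psi>\<in>nonprincipal_characters q. elems B \<psi>). ereal (Re \<rho>))"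

definition R_minus :: "nat \<Rightarrow> zero_system \<Rightarrow> ereal" where
  "R_minus q B = (INF \<rho>\<in>(\<Union>\<psi>\<in>nonprincipal_characters q. elems B \<psi>). ereal (Re \<rho>))"

text \<open>
  Finiteness of multiplicities is part of the convergence of the sum of \<open>n(\<rho>, \<psi>) / |\<rho>|\<close>; it has to
  be stated separately because \<open>card\<close> of an infinite set is \<open>0\<close>. The sum over the characters is
  finite, so the double sum converges iff the inner sum does for each \<open>\<psi>\<close>. The inequality
  \<open>R_minus q B \<le> R_plus q B\<close> excludes the system in which all sequences are empty.
\<close>

definition is_system :: "nat \<Rightarrow> zero_system \<Rightarrow> bool" where
  "is_system q B \<longleftrightarrow>
     (\<forall>\<psi>\<in>nonprincipal_characters q.
        (\<forall>k. B \<psi> k = None \<longrightarrow> B \<psi> (Suc k) = None) \<and>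
        (\<forall>\<rho>\<in>elems B \<psi>. Im \<rho> \<ge> 0) \<and>
        (\<forall>\<rho>\<in>\<real>. multip B \<rho> \<psi> = multip B \<rho> (cnj_character \<psi>)) \<and>
        (\<forall>\<rho>. finite {k. B \<psi> k = Some \<rho>}) \<and>
        (\<lambda>\<rho>. real (multip B \<rho> \<psi>) / norm \<rho>) summable_on elems B \<psi>) \<and>
     1 / 2 < R_minus q B \<and> R_minus q B \<le> R_plus q B \<and> R_plus q B \<le> 1"

definition weight :: "complex \<Rightarrow> real" where
  "weight \<rho> = (if \<rho> \<in> \<real> then 1 / 2 else 1)"

definition P_fun :: "nat \<Rightarrow> zero_system \<Rightarrow> int \<Rightarrow> real \<Rightarrow> real" where
  "P_fun q B a x =
     - 2 / real (totient q) *
         Re (\<Sum>\<psi>\<in>nonprincipal_characters q. cnj (\<psi> a) *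
              (\<Sum>\<^sub>\<infinity>\<rho>\<in>elems B \<psi>. of_real (weight \<rho>) * of_nat (multip B \<rho> \<psi>) * f_rho \<rho> x))
     + real (prime_count x) / real (totient q)"

text \<open>
  Families are functions \<open>F\<close> with \<open>F a x\<close> relevant only for \<open>a\<close> in \<open>carrier (unit_grp q)\<close>
  and \<open>x \<ge> 0\<close>.
\<close>

definition similar ::
  "nat \<Rightarrow> real \<Rightarrow> (int \<Rightarrow> real \<Rightarrow> real) \<Rightarrow> (int \<Rightarrow> real \<Rightarrow> real) \<Rightarrow> bool" where
  "similar q \<beta> F P \<longleftrightarrow>
     (\<forall>a\<in>carrier (unit_grp q). (\<lambda>x. \<bar>F a x - P a x\<bar>) \<in> o(\<lambda>x. x powr \<beta> / ln x))"

definition is_barrier ::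
  "nat \<Rightarrow> zero_system \<Rightarrow> ((int \<Rightarrow> real \<Rightarrow> real) \<Rightarrow> bool) \<Rightarrow> bool" where
  "is_barrier q B I \<longleftrightarrow>
     (\<forall>F. similar q (real_of_ereal (R_minus q B)) F (P_fun q B) \<longrightarrow> \<not> I F)"

definition g_fun :: "nat \<Rightarrow> zero_system \<Rightarrow> complex \<Rightarrow> int \<Rightarrow> int \<Rightarrow> complex" where
  "g_fun q B \<rho> a b =
     (\<Sum>\<psi>\<in>nonprincipal_characters q. of_nat (multip B \<rho> \<psi>) * (\<psi> a - \<psi> b))"

definition beta_sup :: "nat \<Rightarrow> zero_system \<Rightarrow> int \<Rightarrow> int \<Rightarrow> ereal" where
  "beta_sup q B a b = (SUP \<rho>\<in>{\<rho>. g_fun q B \<rho> a b \<noteq> 0}. ereal (Re \<rho>))"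

definition z_set :: "nat \<Rightarrow> zero_system \<Rightarrow> int \<Rightarrow> int \<Rightarrow> complex set" where
  "z_set q B a b =
     (\<Union>\<psi>\<in>nonprincipal_characters q.
        {\<rho>\<in>elems B \<psi>. g_fun q B \<rho> a b \<noteq> 0 \<and> ereal (Re \<rho>) = beta_sup q B a b})"

end

theory Submission
  imports Defs "HOL-Real_Asymp.Real_Asymp"
begin

text \<open>
  Averaging a character over \<open>a\<close> and its inverse leaves only its real part, so the difference between
  \<open>P_fun q B 1\<close> and the mean of \<open>P_fun q B a\<close> and \<open>P_fun q B (inv a)\<close> is, up to the factor
  \<open>-2 / totient q\<close>, the real part of the sum over \<open>\<psi>\<close> and \<open>\<rho>\<close> of
  \<open>(1 - Re (\<psi> a)) * weight \<rho> * multip B \<rho> \<psi> * f_rho \<rho> x\<close>. All these coefficients are nonnegative, so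
  nothing cancels: the \<open>\<rho>\<close> that really occur are exactly those with \<open>g_fun q B \<rho> a 1 \<noteq> 0\<close>
  (\<open>P_fun_1_minus_mean\<close>, \<open>g_fun_1_nonzero_iff\<close>).

  Let \<open>b\<close> be the largest real part among them and divide by \<open>x powr b / ln x\<close>. Since
  \<open>f_rho \<rho> x\<close> is \<open>x powr \<rho> / (\<rho> * ln x)\<close> up to an error that is smaller uniformly in \<open>\<rho>\<close>, dominated
  convergence removes every \<open>\<rho>\<close> with \<open>Re \<rho> < b\<close>, and what remains is a finite sum of terms
  \<open>cis (\<gamma> * ln x) / \<rho>\<close> with positive coefficients, over the \<open>\<rho> = b + \<i> * \<gamma>\<close> in \<open>z_set q B a 1\<close>
  (\<open>f_rho_sum_asymptotics\<close>). If all these terms have real part at most \<open>-\<kappa>\<close>, the class of \<open>1\<close> is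
  strictly ahead, and by a margin that a similar family cannot destroy
  (\<open>eventually_mean_less_at_negative_phases\<close>). It therefore suffices to find arbitrarily large
  \<open>u = ln x\<close> at which this happens for all \<open>a \<in> D\<close> at once.

  For large \<open>\<gamma>\<close> the number \<open>1 / \<rho>\<close> is close to \<open>- \<i> / \<gamma>\<close>, so the real part is negative as soon as
  \<open>sin (\<gamma> * u)\<close> is negative and its modulus is well above \<open>1 / \<gamma>\<close>. Hence everything rests on a
  constant \<open>c > 0\<close> depending only on \<open>n\<close> such that any \<open>n\<close> positive frequencies admit a time at
  which all phases lie in \<open>[c, 1 - c]\<close> modulo \<open>2 * pi\<close> (\<open>phases_in_first_radian\<close>); Dirichlet's
  approximation theorem then provides arbitrarily large times at which all phases are close to the
  negatives of these. The constant found is the reciprocal of an explicit primitive recursive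
  integer, and \<open>\<tau>\<close> is a multiple of that integer.
\<close>

section \<open>Closure properties of recursive functions\<close>

lemma recursive_fn_binop:
  assumes "recursive_fn 2 h" "recursive_fn k f" "recursive_fn k g"
  shows "recursive_fn k (\<lambda>xs. h [f xs, g xs])"
  using recursive_fn.comp[of "[f, g]" h k] assms by (simp add: numeral_2_eq_2)

lemma recursive_fn_Suc:
  assumes "recursive_fn k f"
  shows "recursive_fn k (\<lambda>xs. Suc (f xs))"
  using recursive_fn.comp[of "[f]" "\<lambda>xs. Suc (xs ! 0)" k] recursive_fn.succ assms by simp

lemma recursive_fn_const: "recursive_fn k (\<lambda>_. c)"
  by (induction c) (auto intro: recursive_fn.zero recursive_fn_Suc)

text \<open>
  The functions produced by primitive recursion use \<open>hd\<close> and \<open>tl\<close>, whose values on lists of the wrong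
  length are unspecified. Stating the closure properties for compositions avoids these lists, because
  the outer function then only ever sees an argument list of the right length.
\<close>

lemma recursive_fn_add:
  assumes "recursive_fn k f" "recursive_fn k g"
  shows "recursive_fn k (\<lambda>xs. f xs + g xs)"
proof -
  define h :: "nat list \<Rightarrow> nat" where
    "h = (\<lambda>xs. rec_nat (tl xs ! 0) (\<lambda>y r. Suc ((y # r # tl xs) ! 1)) (hd xs))"
  have "recursive_fn (Suc 1) h"
    unfolding h_def
    by (rule recursive_fn.prim_rec[where g = "\<lambda>xs. Suc (xs ! 1)" and f = "\<lambda>xs. xs ! 0"])
       (auto intro!: recursive_fn.proj recursive_fn_Suc)
  moreover have "h [m, n] = m + n" for m n
    unfolding h_def by (induction m) auto
  ultimately show ?thesis
    using recursive_fn_binop[of h k f g] assms by (simp add: numeral_2_eq_2)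
qed

lemma recursive_fn_mult:
  assumes "recursive_fn k f" "recursive_fn k g"
  shows "recursive_fn k (\<lambda>xs. f xs * g xs)"
proof -
  define h :: "nat list \<Rightarrow> nat" where
    "h = (\<lambda>xs. rec_nat ((\<lambda>_. 0) (tl xs))
            (\<lambda>y r. (y # r # tl xs) ! 2 + (y # r # tl xs) ! 1) (hd xs))"
  have "recursive_fn (Suc 1) h"
    unfolding h_def
    by (rule recursive_fn.prim_rec[where g = "\<lambda>xs. xs ! 2 + xs ! 1" and f = "\<lambda>_. 0"])
       (auto intro!: recursive_fn.proj recursive_fn_add recursive_fn.zero)
  moreover have "h [m, n] = m * n" for m n
    unfolding h_def by (induction m) auto
  ultimately show ?thesis
    using recursive_fn_binop[of h k f g] assms by (simp add: numeral_2_eq_2)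
qed

lemma recursive_fn_power:
  assumes "recursive_fn k f" "recursive_fn k g"
  shows "recursive_fn k (\<lambda>xs. f xs ^ g xs)"
proof -
  define h :: "nat list \<Rightarrow> nat" where
    "h = (\<lambda>xs. rec_nat ((\<lambda>_. 1) (tl xs))
            (\<lambda>y r. (y # r # tl xs) ! 2 * (y # r # tl xs) ! 1) (hd xs))"
  have "recursive_fn (Suc 1) h"
    unfolding h_def
    by (rule recursive_fn.prim_rec[where g = "\<lambda>xs. xs ! 2 * xs ! 1" and f = "\<lambda>_. 1"])
       (auto intro!: recursive_fn.proj recursive_fn_mult recursive_fn_const)
  moreover have "h [m, n] = n ^ m" for m n
    unfolding h_def by (induction m) auto
  ultimately show ?thesis
    using recursive_fn_binop[of h k g f] assms by (simp add: numeral_2_eq_2)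
qed

text \<open>
  The recursion is dictated by the induction step in \<open>phases_in_first_radian\<close>: there \<open>14 * phase_denom n\<close>
  is the precision of a Dirichlet approximation for \<open>n\<close> frequencies, whose multiplier can be as large as
  the \<open>n\<close>-th power of the precision; a further factor absorbs the scale of the previous step.
\<close>

fun phase_denom :: "nat \<Rightarrow> nat" where
  "phase_denom 0 = 2"
| "phase_denom (Suc n) = (14 * phase_denom n) ^ Suc n"

lemma recursive_fn_phase_denom:
  assumes "recursive_fn k f"
  shows "recursive_fn k (\<lambda>xs. phase_denom (f xs))"
proof -
  define h :: "nat list \<Rightarrow> nat" where
    "h = (\<lambda>xs. rec_nat ((\<lambda>_. 2) (tl xs))
            (\<lambda>y r. (14 * (y # r # tl xs) ! 1) ^ Suc ((y # r # tl xs) ! 0)) (hd xs))"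
  have "recursive_fn (Suc 0) h"
    unfolding h_def
    by (rule recursive_fn.prim_rec[where g = "\<lambda>xs. (14 * xs ! 1) ^ Suc (xs ! 0)" and f = "\<lambda>_. 2"])
       (intro recursive_fn.proj recursive_fn_mult recursive_fn_const recursive_fn_power
          recursive_fn_Suc; simp)+
  moreover have "h [n] = phase_denom n" for n
    unfolding h_def by (induction n) auto
  ultimately show ?thesis
    using recursive_fn.comp[of "[f]" h k] assms by simp
qed

lemma computable_real_seq_of_nat:
  assumes "recursive_fn 2 (\<lambda>xs. t (xs ! 0))"
  shows "computable_real_seq (\<lambda>n. real (t n))"
  unfolding computable_real_seq_def
proof (intro exI conjI)
  show "recursive_fn 2 (\<lambda>xs. t (xs ! 0) * Suc (xs ! 1))"
    by (intro recursive_fn_mult recursive_fn_Suc recursive_fn.proj assms) simp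
  show "recursive_fn 2 (\<lambda>_. 0)"
    by (rule recursive_fn.zero)
qed (simp add: field_simps)

section \<open>Simultaneous control of finitely many phases\<close>

lemma phase_denom_pos: "phase_denom n > 0"
  by (induction n) auto

lemma phase_denom_Suc_ge: "2 * phase_denom n \<le> phase_denom (Suc n)"
proof -
  have "2 * phase_denom n * 1 \<le> (14 * phase_denom n) * (14 * phase_denom n) ^ n"
    using phase_denom_pos[of n] by (intro mult_mono) auto
  then show ?thesis by simp
qed

lemma phase_denom_ge_2: "phase_denom n \<ge> 2"
proof (induction n)
  case (Suc n)
  then show ?case using phase_denom_Suc_ge[of n] by linarith
qed simp

lemma dirichlet_approximation_finite_set:
  fixes S :: "real set" and \<theta> :: "real \<Rightarrow> real"
  assumes "finite S" "N > 0"
  obtains m :: nat and p :: "real \<Rightarrow> int"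
    where "1 \<le> m" "m \<le> N ^ card S" "\<And>s. s \<in> S \<Longrightarrow> \<bar>real m * \<theta> s - of_int (p s)\<bar> < 1 / real N"
proof -
  obtain h where h: "bij_betw h {0..<card S} S"
    using ex_bij_betw_nat_finite[OF assms(1)] by blast
  obtain r p where rp: "0 < r" "r \<le> int (N ^ card S)"
      "\<And>i. i < card S \<Longrightarrow> \<bar>of_int r * \<theta> (h i) - of_int (p i)\<bar> < 1 / real N"
    using Dirichlet_approx_simult[OF assms(2), where n = "card S" and \<theta> = "\<lambda>i. \<theta> (h i)"] by metis
  show ?thesis
  proof (rule that[of "nat r" "\<lambda>s. p (inv_into {0..<card S} h s)"])
    show "1 \<le> nat r" "nat r \<le> N ^ card S" using rp(1,2) by (auto simp: nat_le_iff)
    fix s assume s: "s \<in> S"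
    then have "inv_into {0..<card S} h s < card S" "h (inv_into {0..<card S} h s) = s"
      using bij_betw_inv_into_right[OF h s] bij_betwE[OF bij_betw_inv_into[OF h]] by auto
    then show "\<bar>real (nat r) * \<theta> s - of_int (p (inv_into {0..<card S} h s))\<bar> < 1 / real N"
      using rp(1) rp(3)[of "inv_into {0..<card S} h s"] by simp
  qed
qed

text \<open>
  Induction on the number of frequencies, splitting off the smallest one, \<open>\<mu>\<close>. Let \<open>t\<close> be the time
  obtained for the others. By Dirichlet's theorem there is an additional time \<open>d\<close> that hardly moves the
  phases of the other frequencies, while \<open>\<mu> * d\<close> is at most \<open>c n / 2\<close> and yet bounded below. So
  \<open>t + d\<close> keeps the other phases in place, and it remains to control \<open>\<mu> * (t + d)\<close> itself.
  That is the purpose of the last conjunct: as \<open>\<mu>\<close> is smaller than the other frequencies, it gives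
  \<open>\<mu> * t \<le> 1 - c n\<close>, so the phase of \<open>\<mu>\<close> needs no reduction modulo \<open>2 * pi\<close> at all.
  The conjunct quantifies over lower bounds \<open>y\<close> of \<open>S\<close> rather than using the minimum so that
  for \<open>S = {}\<close> it forces \<open>t\<close> to vanish, which makes the case of a single frequency uniform.
\<close>

lemma phases_in_first_radian:
  fixes S :: "real set"
  assumes "finite S" "card S \<le> n" "\<And>\<gamma>. \<gamma> \<in> S \<Longrightarrow> \<gamma> > 0"
  defines "c \<equiv> \<lambda>n. 1 / real (phase_denom n)"
  shows "\<exists>t\<ge>0. (\<forall>\<gamma>\<in>S. \<exists>k::int. c n \<le> \<gamma> * t - 2 * pi * k \<and> \<gamma> * t - 2 * pi * k \<le> 1 - c n) \<and>
           (\<forall>y>0. (\<forall>\<gamma>\<in>S. y \<le> \<gamma>) \<longrightarrow> y * t \<le> 1 - c n)"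
  using assms(1-3)
proof (induction n arbitrary: S)
  case 0
  then have "S = {}" by auto
  then show ?case by (intro exI[of _ 0]) (auto simp: c_def)
next
  case (Suc n)
  have c_pos: "c n > 0" "c (Suc n) > 0" by (simp_all add: c_def phase_denom_pos del: phase_denom.simps)
  have "real (2 * phase_denom n) \<le> real (phase_denom (Suc n))"
    using phase_denom_Suc_ge[of n] by (rule of_nat_mono)
  then have c_half: "c (Suc n) \<le> c n / 2"
    using phase_denom_pos[of n] phase_denom_pos[of "Suc n"]
    by (simp add: c_def field_simps del: phase_denom.simps)
  have c_le: "c n \<le> 1 / 2"
    using phase_denom_ge_2[of n] by (simp add: c_def field_simps)
  show ?case
  proof (cases "S = {}")
    case True
    then show ?thesis
    using c_half c_le c_pos by (intro exI[of _ 0]) auto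
  next
    case False
    define \<mu> where "\<mu> = Min S"
    define S' where "S' = S - {\<mu>}"
    have \<mu>: "\<mu> \<in> S" "\<And>\<gamma>. \<gamma> \<in> S \<Longrightarrow> \<mu> \<le> \<gamma>"
      using False Suc.prems(1) by (auto simp: \<mu>_def)
    have \<mu>_pos: "\<mu> > 0" using \<mu>(1) Suc.prems(3) by blast
    have S': "finite S'" "card S' \<le> n" "\<And>\<gamma>. \<gamma> \<in> S' \<Longrightarrow> \<gamma> > 0"
      using Suc.prems \<mu>(1) by (auto simp: S'_def)
    obtain t where t: "t \<ge> 0"
      "\<And>\<gamma>. \<gamma> \<in> S' \<Longrightarrow> \<exists>k::int. c n \<le> \<gamma> * t - 2 * pi * k \<and> \<gamma> * t - 2 * pi * k \<le> 1 - c n"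
      "\<And>y. y > 0 \<Longrightarrow> (\<And>\<gamma>. \<gamma> \<in> S' \<Longrightarrow> y \<le> \<gamma>) \<Longrightarrow> y * t \<le> 1 - c n"
      using Suc.IH[OF S'] by blast
    \<comment> \<open>\<open>14\<close> is an integer above \<open>4 * pi\<close>, so that phases within \<open>2 * pi / N\<close> are within \<open>c n / 2\<close>.\<close>
    define N where "N = 14 * phase_denom n"
    have N: "N > 0" "2 * pi / real N \<le> c n / 2"
      using phase_denom_pos[of n] pi_less_4 pi_approx(2)
      by (simp_all add: N_def c_def field_simps)
    \<comment> \<open>The unit of time is such that even the largest multiplier keeps the phase of \<open>\<mu>\<close> below \<open>c n / 2\<close>.\<close>
    define \<sigma> where "\<sigma> = c n / 2 / (real (N ^ n) * \<mu>)"
    have \<sigma>: "\<sigma> > 0" "\<mu> * \<sigma> = c n / 2 / real (N ^ n)"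
      using N(1) \<mu>_pos c_pos by (simp_all add: \<sigma>_def)
    obtain m p where m: "1 \<le> m" "m \<le> N ^ card S'"
      "\<And>\<gamma>. \<gamma> \<in> S' \<Longrightarrow> \<bar>real m * (\<gamma> * \<sigma> / (2 * pi)) - of_int (p \<gamma>)\<bar> < 1 / real N"
      using dirichlet_approximation_finite_set[OF S'(1) N(1), of "\<lambda>\<gamma>. \<gamma> * \<sigma> / (2 * pi)"] by blast
    have mN: "m \<le> N ^ n"
      using m(2) S'(2) N(1) power_increasing[of "card S'" n N] by linarith
    define d where "d = real m * \<sigma>"
    have d0: "d > 0" using m(1) \<sigma>(1) by (simp add: d_def)
    have d_near: "\<bar>\<gamma> * d - 2 * pi * p \<gamma>\<bar> \<le> c n / 2" if "\<gamma> \<in> S'" for \<gamma>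
    proof -
      have "\<gamma> * d - 2 * pi * p \<gamma> = 2 * pi * (real m * (\<gamma> * \<sigma> / (2 * pi)) - of_int (p \<gamma>))"
        by (simp add: d_def field_simps)
      also have "\<bar>\<dots>\<bar> = 2 * pi * \<bar>real m * (\<gamma> * \<sigma> / (2 * pi)) - of_int (p \<gamma>)\<bar>"
        by (simp add: abs_mult)
      also have "\<dots> \<le> 2 * pi * (1 / real N)"
        using m(3)[OF that] by (intro mult_left_mono) auto
      also have "\<dots> \<le> c n / 2" using N(2) by simp
      finally show ?thesis .
    qed
    have \<mu>d_eq: "\<mu> * d = real m * (c n / 2 / real (N ^ n))"
      unfolding d_def \<sigma>(2)[symmetric] by simp
    have \<mu>d_le: "\<mu> * d \<le> c n / 2"
    proof -
      have "real m * (c n / 2 / real (N ^ n)) \<le> real (N ^ n) * (c n / 2 / real (N ^ n))"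
        using mN c_pos by (intro mult_right_mono) (auto simp del: of_nat_power)
      then show ?thesis using N(1) \<mu>d_eq by simp
    qed
    have \<mu>d_ge: "\<mu> * d \<ge> c (Suc n)"
    proof -
      have "c (Suc n) \<le> c n / 2 / real (N ^ n)"
        using phase_denom_pos[of n] by (simp add: c_def N_def field_simps)
      also have "\<dots> \<le> real m * (c n / 2 / real (N ^ n))"
        using mult_right_mono[of 1 "real m" "c n / 2 / real (N ^ n)"] m(1) c_pos by simp
      finally show ?thesis using \<mu>d_eq by simp
    qed
    have bound: "y * (t + d) \<le> 1 - c (Suc n)" if "y > 0" "\<And>\<gamma>. \<gamma> \<in> S \<Longrightarrow> y \<le> \<gamma>" for y
    proof -
      have "y * t \<le> 1 - c n" using t(3)[OF that(1)] that(2) by (auto simp: S'_def)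
      moreover have "y * d \<le> \<mu> * d" using that(2)[OF \<mu>(1)] d0 by simp
      ultimately show ?thesis using \<mu>d_le c_half by (simp add: algebra_simps)
    qed
    have "\<exists>k::int. c (Suc n) \<le> \<gamma> * (t + d) - 2 * pi * k \<and> \<gamma> * (t + d) - 2 * pi * k \<le> 1 - c (Suc n)"
      if "\<gamma> \<in> S" for \<gamma>
    proof (cases "\<gamma> = \<mu>")
      case True
      have "\<mu> * t \<ge> 0" using \<mu>_pos t(1) by simp
      then show ?thesis
        using True bound[OF \<mu>_pos \<mu>(2)] \<mu>d_ge by (intro exI[of _ 0]) (simp add: algebra_simps)
    next
      case False
      with that have g: "\<gamma> \<in> S'" by (simp add: S'_def)
      obtain k :: int where "c n \<le> \<gamma> * t - 2 * pi * k" "\<gamma> * t - 2 * pi * k \<le> 1 - c n"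
        using t(2)[OF g] by blast
      then show ?thesis
        using d_near[OF g] c_half
        unfolding abs_le_iff distrib_left
        by (intro exI[of _ "k + p \<gamma>"]) (unfold of_int_add distrib_left, linarith)
    qed
    then show ?thesis using bound t(1) d0 by (intro exI[of _ "t + d"]) auto
  qed
qed

lemma sin_ge_half:
  fixes x :: real
  assumes "0 \<le> x" "x \<le> 1"
  shows "x / 2 \<le> sin x"
proof -
  have "sin 0 - 0 / 2 \<le> sin x - x / 2"
  proof (rule DERIV_nonneg_imp_nondecreasing[OF assms(1), of "\<lambda>x. sin x - x / 2"])
    fix y :: real assume y: "0 \<le> y" "y \<le> x"
    have "cos (pi / 3) \<le> cos y"
      using y assms pi_gt3 by (intro cos_monotone_0_pi_le) auto
    then show "\<exists>d. ((\<lambda>x. sin x - x / 2) has_real_derivative d) (at y) \<and> 0 \<le> d"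
      by (intro exI[of _ "cos y - 1 / 2"] conjI)
         (auto intro!: derivative_eq_intros simp: cos_60)
  qed
  then show ?thesis by simp
qed

text \<open>
  With \<open>t\<close> from \<open>phases_in_first_radian\<close>, take \<open>u = m * Y - t\<close>, where \<open>m \<ge> 1\<close> makes all phases \<open>\<gamma> * m * Y\<close>
  almost multiples of \<open>2 * pi\<close> and \<open>Y\<close> is as large as needed. Then \<open>\<gamma> * u\<close> is congruent to some \<open>-\<theta>\<close>
  with \<open>c / 2 \<le> \<theta> \<le> 1\<close>. The real part in question has numerator
  \<open>Re \<rho> * cos \<theta> - \<gamma> * sin \<theta> \<le> 1 - \<gamma> * c / 4\<close>, and the lower bound on \<open>\<gamma>\<close> makes this at most \<open>-1\<close>.
\<close>

lemma simultaneous_negative_real_parts: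
  fixes S :: "real set"
  assumes "finite S" "card S \<le> n" "\<And>\<gamma>. \<gamma> \<in> S \<Longrightarrow> \<gamma> \<ge> real (8 * phase_denom n)"
  shows "\<exists>\<kappa>>0. \<forall>X. \<exists>u\<ge>X. \<forall>\<rho>. Im \<rho> \<in> S \<and> 0 \<le> Re \<rho> \<and> Re \<rho> \<le> 1 \<longrightarrow> Re (cis (Im \<rho> * u) / \<rho>) \<le> - \<kappa>"
proof -
  define c where "c = 1 / real (phase_denom n)"
  have c: "c > 0" by (simp add: c_def phase_denom_pos)
  have big: "\<gamma> * c \<ge> 8" if "\<gamma> \<in> S" for \<gamma>
    using assms(3)[OF that] phase_denom_pos[of n] by (simp add: c_def field_simps)
  have pos: "\<gamma> > 0" if "\<gamma> \<in> S" for \<gamma>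
    using assms(3)[OF that] phase_denom_pos[of n] by (simp add: order_less_le_trans)
  obtain t where t:
    "\<And>\<gamma>. \<gamma> \<in> S \<Longrightarrow> \<exists>k::int. c \<le> \<gamma> * t - 2 * pi * k \<and> \<gamma> * t - 2 * pi * k \<le> 1 - c"
    using phases_in_first_radian[OF assms(1,2) pos] unfolding c_def by blast
  obtain M where M: "\<And>\<gamma>. \<gamma> \<in> S \<Longrightarrow> \<gamma> \<le> M"
    using assms(1) by (meson Max_ge)
  define \<kappa> where "\<kappa> = 1 / (1 + M\<^sup>2)"
  have den: "1 + M\<^sup>2 > 0" by (meson add_pos_nonneg zero_less_one zero_le_power2)
  have "\<exists>u\<ge>X. \<forall>\<rho>. Im \<rho> \<in> S \<and> 0 \<le> Re \<rho> \<and> Re \<rho> \<le> 1 \<longrightarrow> Re (cis (Im \<rho> * u) / \<rho>) \<le> - \<kappa>" for X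
  proof -
    define N where "N = 14 * phase_denom n"
    have N: "N > 0" "2 * pi / real N \<le> c / 2"
      using phase_denom_pos[of n] pi_less_4 pi_approx(2)
      by (simp_all add: N_def c_def field_simps)
    define Y where "Y = \<bar>X\<bar> + \<bar>t\<bar>"
    obtain m p where m: "1 \<le> m"
      "\<And>\<gamma>. \<gamma> \<in> S \<Longrightarrow> \<bar>real m * (\<gamma> * Y / (2 * pi)) - of_int (p \<gamma>)\<bar> < 1 / real N"
      using dirichlet_approximation_finite_set[OF assms(1) N(1), of "\<lambda>\<gamma>. \<gamma> * Y / (2 * pi)"] by metis
    define u where "u = real m * Y - t"
    have "u \<ge> X"
    proof -
      have "real m * Y \<ge> 1 * Y" using m(1) by (intro mult_right_mono) (auto simp: Y_def)
      then show ?thesis by (simp add: u_def Y_def)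
    qed
    moreover have "Re (cis (Im \<rho> * u) / \<rho>) \<le> - \<kappa>"
      if \<rho>: "Im \<rho> \<in> S" "0 \<le> Re \<rho>" "Re \<rho> \<le> 1" for \<rho>
    proof -
      define \<gamma> where "\<gamma> = Im \<rho>"
      obtain k :: int where k: "c \<le> \<gamma> * t - 2 * pi * k" "\<gamma> * t - 2 * pi * k \<le> 1 - c"
        using t \<rho>(1) by (auto simp: \<gamma>_def)
      define \<theta> where "\<theta> = 2 * pi * (p \<gamma> - k) - \<gamma> * u"
      have "\<gamma> * (real m * Y) - 2 * pi * p \<gamma> = 2 * pi * (real m * (\<gamma> * Y / (2 * pi)) - of_int (p \<gamma>))"
        by (simp add: field_simps)
      also have "\<bar>\<dots>\<bar> = 2 * pi * \<bar>real m * (\<gamma> * Y / (2 * pi)) - of_int (p \<gamma>)\<bar>"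
        by (simp add: abs_mult)
      also have "\<dots> \<le> 2 * pi * (1 / real N)"
        using m(2)[of \<gamma>] \<rho>(1) by (intro mult_left_mono) (auto simp: \<gamma>_def)
      also have "\<dots> \<le> c / 2" using N(2) by simp
      finally have "\<bar>\<gamma> * (real m * Y) - 2 * pi * p \<gamma>\<bar> \<le> c / 2" .
      then have \<theta>: "c / 2 \<le> \<theta>" "\<theta> \<le> 1"
        using k c unfolding abs_le_iff \<theta>_def u_def of_int_diff right_diff_distrib by linarith+
      have \<gamma>u: "\<gamma> * u = - \<theta> + 2 * pi * of_int (p \<gamma> - k)" by (simp add: \<theta>_def)
      have "sin (\<gamma> * u) = sin (- \<theta>) \<and> cos (\<gamma> * u) = cos (- \<theta>)"
        unfolding sin_cos_eq_iff \<gamma>u by (rule exI[of _ "p \<gamma> - k"]) simp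
      then have "sin (\<gamma> * u) = - sin \<theta>" "cos (\<gamma> * u) = cos \<theta>" by simp_all
      moreover have "sin \<theta> \<ge> c / 4"
        using sin_ge_half[of \<theta>] \<theta> c by linarith
      then have "\<gamma> * sin \<theta> \<ge> \<gamma> * (c / 4)" using pos[of \<gamma>] \<rho>(1) by (simp add: \<gamma>_def)
      moreover have "Re \<rho> * cos \<theta> \<le> 1 * 1"
        using \<rho> cos_le_one[of \<theta>] mult_left_mono[of "cos \<theta>" 1 "Re \<rho>"] by simp
      ultimately have num: "Re \<rho> * cos (\<gamma> * u) + \<gamma> * sin (\<gamma> * u) \<le> -1"
        using big[of \<gamma>] \<rho>(1) by (simp add: \<gamma>_def)
      have d0: "(Re \<rho>)\<^sup>2 + \<gamma>\<^sup>2 > 0" using pos[of \<gamma>] \<rho>(1) by (simp add: \<gamma>_def sum_power2_gt_zero_iff)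
      have "(Re \<rho>)\<^sup>2 \<le> 1" using \<rho> by (simp add: power_le_one)
      moreover have "\<gamma>\<^sup>2 \<le> M\<^sup>2" using M pos \<rho>(1) by (intro power_mono) (auto simp: \<gamma>_def less_imp_le)
      ultimately have "1 / (1 + M\<^sup>2) \<le> 1 / ((Re \<rho>)\<^sup>2 + \<gamma>\<^sup>2)"
        using d0 by (intro divide_left_mono) auto
      moreover have "Re (cis (\<gamma> * u) / \<rho>) = (Re \<rho> * cos (\<gamma> * u) + \<gamma> * sin (\<gamma> * u)) / ((Re \<rho>)\<^sup>2 + \<gamma>\<^sup>2)"
        by (simp add: Re_divide \<gamma>_def algebra_simps)
      moreover have "\<dots> \<le> (- 1) / ((Re \<rho>)\<^sup>2 + \<gamma>\<^sup>2)"
        using num d0 by (intro divide_right_mono) auto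
      ultimately show ?thesis unfolding \<kappa>_def \<gamma>_def by simp
    qed
    ultimately show ?thesis by blast
  qed
  moreover have "\<kappa> > 0" using den by (simp add: \<kappa>_def)
  ultimately show ?thesis by blast
qed

section \<open>Asymptotics of sums of the functions f\<close>

lemma continuous_on_tail_integrand:
  "continuous_on {2..x} (\<lambda>t::real. t powr (-3/4) / (ln t)\<^sup>2)"
  by (intro continuous_intros) auto

text \<open>
  The exponent \<open>-3/4\<close> is \<open>1/4 - 1\<close>: this is the tail integral in \<open>f_rho\<close> for real part \<open>1/4\<close>. By
  l'Hospital's rule it is \<open>o(x powr (1/4) / ln x)\<close>; \<open>norm_f_rho_minus_main_le\<close> reduces all other
  \<open>\<rho>\<close> to it.
\<close>

lemma tail_integral_negligible:
  "((\<lambda>x::real. ln x * (x powr (-1/4) * integral {2..x} (\<lambda>t. t powr (-3/4) / (ln t)\<^sup>2))) \<longlongrightarrow> 0) at_top"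
proof -
  let ?J = "\<lambda>x. integral {2..x} (\<lambda>t::real. t powr (-3/4) / (ln t)\<^sup>2)"
  have "((\<lambda>x. ?J x / (x powr (1/4) / ln x)) \<longlongrightarrow> 0) at_top"
  proof (rule lhospital_at_top_at_top)
    show "filterlim (\<lambda>x::real. x powr (1/4) / ln x) at_top at_top" by real_asymp
    show "\<forall>\<^sub>F x::real in at_top. x powr (-3/4) / 4 / ln x - x powr (-3/4) / (ln x)\<^sup>2 \<noteq> 0"
    proof -
      have "\<forall>\<^sub>F x::real in at_top. x powr (-3/4) / 4 / ln x - x powr (-3/4) / (ln x)\<^sup>2 > 0"
        by real_asymp
      then show ?thesis by (rule eventually_mono) (rule less_imp_neq[symmetric])
    qed
    show "\<forall>\<^sub>F x in at_top. (?J has_real_derivative x powr (-3/4) / (ln x)\<^sup>2) (at x)"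
      using eventually_gt_at_top[of 2]
    proof eventually_elim
      case (elim x)
      have "(?J has_real_derivative x powr (-3/4) / (ln x)\<^sup>2) (at x within {2..x + 1})"
        using elim by (intro integral_has_real_derivative continuous_on_tail_integrand) auto
      moreover have "x \<in> interior {2..x + 1}" using elim by simp
      ultimately show ?case by (simp only: at_within_interior)
    qed
    show "\<forall>\<^sub>F x::real in at_top. ((\<lambda>x. x powr (1/4) / ln x) has_real_derivative
            x powr (-3/4) / 4 / ln x - x powr (-3/4) / (ln x)\<^sup>2) (at x)"
      using eventually_gt_at_top[of 2]
    proof eventually_elim
      case (elim x)
      have "x powr (1/4) / x = x powr (-3/4)"
        using elim powr_diff[of x "1/4" 1] by simp
      then show ?case
        using elim by (auto intro!: derivative_eq_intros simp: field_simps power2_eq_square)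
    qed
    show "((\<lambda>x::real. x powr (-3/4) / (ln x)\<^sup>2 /
            (x powr (-3/4) / 4 / ln x - x powr (-3/4) / (ln x)\<^sup>2)) \<longlongrightarrow> 0) at_top"
      by real_asymp
  qed
  moreover have "\<forall>\<^sub>F x in at_top. ?J x / (x powr (1/4) / ln x) = ln x * (x powr (-1/4) * ?J x)"
    using eventually_gt_at_top[of 2]
    by eventually_elim (simp add: powr_minus field_simps)
  ultimately show ?thesis by (rule Lim_transform_eventually)
qed

text \<open>
  Writing \<open>t powr (Re \<rho> - 1)\<close> as \<open>t powr (Re \<rho> - 1/4) * t powr (-3/4)\<close> and bounding the first factor by its
  value at \<open>x\<close> leaves an integral without \<open>\<rho>\<close>. The relative error is therefore uniform in \<open>\<rho>\<close>, as
  is needed to sum over infinitely many \<open>\<rho>\<close>.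
\<close>

lemma norm_f_rho_minus_main_le:
  assumes "1 / 4 \<le> Re \<rho>" "x \<ge> 2"
  shows "norm (f_rho \<rho> x - of_real x powr \<rho> / (\<rho> * of_real (ln x))) \<le>
           x powr Re \<rho> / norm \<rho> * (x powr (-1/4) * integral {2..x} (\<lambda>t. t powr (-3/4) / (ln t)\<^sup>2))"
proof -
  let ?h = "\<lambda>t. t powr (-3/4) / (ln t)\<^sup>2"
  let ?F = "\<lambda>t. complex_of_real t powr \<rho> / of_real (t * (ln t)\<^sup>2)"
  have "norm (integral {2..x} ?F) \<le> integral {2..x} (\<lambda>t. x powr (Re \<rho> - 1/4) * ?h t)"
  proof (rule integral_norm_bound_integral)
    show "?F integrable_on {2..x}"
      by (intro integrable_continuous_real continuous_intros) (auto simp: complex_nonpos_Reals_iff)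
    show "(\<lambda>t. x powr (Re \<rho> - 1/4) * ?h t) integrable_on {2..x}"
      by (intro integrable_continuous_real continuous_on_mult continuous_on_const
            continuous_on_tail_integrand)
    fix t assume t: "t \<in> {2..x}"
    have "norm (?F t) = t powr Re \<rho> / t / (ln t)\<^sup>2"
      using t by (simp add: norm_divide norm_mult norm_power norm_powr_real_powr)
    also have "t powr Re \<rho> / t = t powr (Re \<rho> - 1)"
      using t by (simp add: powr_diff)
    also have "Re \<rho> - 1 = (Re \<rho> - 1/4) + (-3/4)"
      by simp
    also have "t powr \<dots> = t powr (Re \<rho> - 1/4) * t powr (-3/4)"
      by (rule powr_add)
    also have "\<dots> / (ln t)\<^sup>2 \<le> x powr (Re \<rho> - 1/4) * t powr (-3/4) / (ln t)\<^sup>2"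
      using t assms by (intro divide_right_mono mult_right_mono powr_mono2) auto
    finally show "norm (?F t) \<le> x powr (Re \<rho> - 1/4) * ?h t" by simp
  qed
  also have "\<dots> = x powr Re \<rho> * (x powr (-1/4) * integral {2..x} ?h)"
    unfolding integral_mult_right using powr_add[of x "Re \<rho>" "-1/4"] by simp
  finally show ?thesis
    by (simp add: f_rho_def norm_divide divide_right_mono)
qed

text \<open>
  Tannery's theorem for sums over an arbitrary index set, in the case of limit zero: the majorant makes
  the finite partial sums converge uniformly, so the two limits can be exchanged.
\<close>

lemma infsum_tendsto_zero_dominated:
  fixes r :: "'a \<Rightarrow> 'b \<Rightarrow> 'c :: banach"
  assumes "M summable_on A"
    and "\<forall>\<^sub>F x in G. \<forall>a\<in>A. norm (r a x) \<le> M a"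
    and "\<And>a. a \<in> A \<Longrightarrow> (r a \<longlongrightarrow> 0) G"
  shows "((\<lambda>x. \<Sum>\<^sub>\<infinity>a\<in>A. r a x) \<longlongrightarrow> 0) G"
proof (rule swap_uniform_limit')
  show "\<forall>\<^sub>F X in finite_subsets_at_top A. ((\<lambda>x. \<Sum>a\<in>X. r a x) \<longlongrightarrow> 0) G"
    by (rule eventually_finite_subsets_at_top_weakI) (use assms(3) in \<open>auto intro!: tendsto_null_sum\<close>)
  show "((\<lambda>_. 0) \<longlongrightarrow> (0::'c)) (finite_subsets_at_top A)" by simp
  show "uniform_limit {x. \<forall>a\<in>A. norm (r a x) \<le> M a} (\<lambda>X x. \<Sum>a\<in>X. r a x)
          (\<lambda>x. \<Sum>\<^sub>\<infinity>a\<in>A. r a x) (finite_subsets_at_top A)"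
    by (rule Weierstrass_m_test_general[OF _ assms(1)]) auto
  show "\<forall>\<^sub>F x in G. x \<in> {x. \<forall>a\<in>A. norm (r a x) \<le> M a}" using assms(2) by simp
qed simp

text \<open>
  Subtract from the normalised \<open>f_rho \<rho> x\<close> its limiting oscillation, which is present only for
  \<open>Re \<rho> = b\<close>. The rest \<open>r \<rho> x\<close> is at most \<open>v \<rho> / norm \<rho>\<close> times the sum of a uniform error \<open>e x\<close> and
  \<open>x powr (Re \<rho> - b)\<close>, the latter only for \<open>Re \<rho> < b\<close>. It tends to zero for each \<open>\<rho>\<close>, but
  not uniformly because the real parts may accumulate at \<open>b\<close>; hence dominated convergence.
\<close>

lemma f_rho_sum_asymptotics:
  fixes A :: "complex set" and v :: "complex \<Rightarrow> real"
  assumes sum: "(\<lambda>\<rho>. v \<rho> / norm \<rho>) summable_on A"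
    and v: "\<And>\<rho>. \<rho> \<in> A \<Longrightarrow> v \<rho> \<ge> 0"
    and Re: "\<And>\<rho>. \<rho> \<in> A \<Longrightarrow> 1 / 4 \<le> Re \<rho> \<and> Re \<rho> \<le> b"
    and fin: "finite {\<rho>\<in>A. Re \<rho> = b}"
  shows "((\<lambda>x. of_real (ln x / x powr b) * (\<Sum>\<^sub>\<infinity>\<rho>\<in>A. of_real (v \<rho>) * f_rho \<rho> x) -
            (\<Sum>\<rho>\<in>{\<rho>\<in>A. Re \<rho> = b}. of_real (v \<rho>) * (cis (Im \<rho> * ln x) / \<rho>))) \<longlongrightarrow> 0) at_top"
proof -
  define e where "e = (\<lambda>x::real. ln x * (x powr (-1/4) * integral {2..x} (\<lambda>t. t powr (-3/4) / (ln t)\<^sup>2)))"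
  define top where "top = (\<lambda>\<rho> x. if Re \<rho> = b then of_real (v \<rho>) * (cis (Im \<rho> * ln x) / \<rho>) else 0)"
  define r where "r = (\<lambda>\<rho> x. of_real (ln x / x powr b) * (of_real (v \<rho>) * f_rho \<rho> x) - top \<rho> x)"
  define s where "s = (\<lambda>\<rho> x. if Re \<rho> = b then 0 else (x::real) powr (Re \<rho> - b))"
  have e_lim: "(e \<longlongrightarrow> 0) at_top" unfolding e_def by (rule tail_integral_negligible)
  have r_le: "norm (r \<rho> x) \<le> v \<rho> / norm \<rho> * (e x + s \<rho> x)" if \<rho>: "\<rho> \<in> A" and x: "x \<ge> 2" for \<rho> x
  proof -
    let ?m = "of_real x powr \<rho> / (\<rho> * of_real (ln x))"
    let ?L = "ln x / x powr b"
    have \<rho>0: "\<rho> \<noteq> 0" using Re[OF \<rho>] by auto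
    have L: "?L \<ge> 0" using x by simp
    have "of_real x powr \<rho> = of_real (x powr Re \<rho>) * cis (Im \<rho> * ln x)"
      using x by (simp add: powr_def exp_eq_polar Ln_of_real)
    then have main: "of_real ?L * ?m = of_real (x powr (Re \<rho> - b)) * (cis (Im \<rho> * ln x) / \<rho>)"
      using x \<rho>0 by (simp add: powr_diff field_simps)
    have "r \<rho> x = of_real (v \<rho>) * (of_real ?L * (f_rho \<rho> x - ?m) + of_real ?L * ?m) - top \<rho> x"
      by (simp add: r_def algebra_simps)
    also have "\<dots> = of_real (v \<rho>) * (of_real ?L * (f_rho \<rho> x - ?m)
        + of_real (s \<rho> x) * (cis (Im \<rho> * ln x) / \<rho>))"
      using x unfolding main by (auto simp: top_def s_def algebra_simps)
    also have "norm \<dots> \<le> v \<rho> * (?L * norm (f_rho \<rho> x - ?m) + s \<rho> x * (1 / norm \<rho>))"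
    proof -
      have "norm (of_real ?L * (f_rho \<rho> x - ?m) + of_real (s \<rho> x) * (cis (Im \<rho> * ln x) / \<rho>))
          \<le> norm (of_real ?L * (f_rho \<rho> x - ?m)) + norm (of_real (s \<rho> x) * (cis (Im \<rho> * ln x) / \<rho>))"
        by (rule norm_triangle_ineq)
      also have "\<dots> = ?L * norm (f_rho \<rho> x - ?m) + s \<rho> x * (1 / norm \<rho>)"
        using L unfolding norm_mult norm_divide norm_cis norm_of_real by (simp only: abs_of_nonneg) (simp add: s_def)
      finally show ?thesis
        unfolding norm_mult norm_of_real using v[OF \<rho>] by (simp add: mult_left_mono)
    qed
    also have "\<dots> \<le> v \<rho> * (e x / norm \<rho> + s \<rho> x * (1 / norm \<rho>))"
    proof (intro mult_left_mono add_right_mono v[OF \<rho>])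
      let ?E = "x powr (-1/4) * integral {2..x} (\<lambda>t. t powr (-3/4) / (ln t)\<^sup>2)"
      have "?L * norm (f_rho \<rho> x - ?m) \<le> ?L * (x powr Re \<rho> / norm \<rho> * ?E)"
        using norm_f_rho_minus_main_le Re[OF \<rho>] x L by (intro mult_left_mono) auto
      also have "\<dots> = x powr (Re \<rho> - b) * (e x / norm \<rho>)"
        by (simp add: e_def powr_diff)
      also have "\<dots> \<le> 1 * (e x / norm \<rho>)"
      proof (rule mult_right_mono)
        show "x powr (Re \<rho> - b) \<le> 1"
          using powr_mono[of "Re \<rho> - b" 0 x] Re[OF \<rho>] x by simp
        have "integral {2..x} (\<lambda>t. t powr (-3/4) / (ln t)\<^sup>2) \<ge> 0"
          by (intro Henstock_Kurzweil_Integration.integral_nonneg integrable_continuous_real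
                continuous_on_tail_integrand) auto
        then show "0 \<le> e x / norm \<rho>" using x by (simp add: e_def)
      qed
      finally show "?L * norm (f_rho \<rho> x - ?m) \<le> e x / norm \<rho>" by simp
    qed
    finally show ?thesis by (simp add: distrib_left add_divide_distrib mult.commute)
  qed
  have s_le: "s \<rho> x \<le> 1" if "\<rho> \<in> A" "x \<ge> 2" for \<rho> x
    using powr_mono[of "Re \<rho> - b" 0 x] Re[OF that(1)] that by (simp add: s_def)
  have "((\<lambda>x. \<Sum>\<^sub>\<infinity>\<rho>\<in>A. r \<rho> x) \<longlongrightarrow> 0) at_top"
  proof (rule infsum_tendsto_zero_dominated)
    show "(\<lambda>\<rho>. v \<rho> / norm \<rho> * 2) summable_on A"
      by (rule summable_on_cmult_left[OF sum])
    have "\<forall>\<^sub>F x in at_top. e x < 1" using e_lim by (rule order_tendstoD) simp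
    then show "\<forall>\<^sub>F x in at_top. \<forall>\<rho>\<in>A. norm (r \<rho> x) \<le> v \<rho> / norm \<rho> * 2"
      using eventually_ge_at_top[of 2]
    proof eventually_elim
      case (elim x)
      show ?case
      proof
        fix \<rho> assume \<rho>: "\<rho> \<in> A"
        have "v \<rho> / norm \<rho> * (e x + s \<rho> x) \<le> v \<rho> / norm \<rho> * 2"
          using s_le[OF \<rho>, of x] elim v[OF \<rho>] by (intro mult_left_mono) auto
        then show "norm (r \<rho> x) \<le> v \<rho> / norm \<rho> * 2"
          using r_le[OF \<rho>, of x] elim by simp
      qed
    qed
    fix \<rho> assume \<rho>: "\<rho> \<in> A"
    have "(s \<rho> \<longlongrightarrow> 0) at_top"
    proof (cases "Re \<rho> = b")
      case False
      then have "Re \<rho> - b < 0" using Re[OF \<rho>] by simp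
      then have "((\<lambda>x. x powr (Re \<rho> - b)) \<longlongrightarrow> 0) at_top"
        by (rule tendsto_neg_powr) (rule filterlim_ident)
      then show ?thesis using False by (simp add: s_def)
    qed (simp add: s_def)
    then have "((\<lambda>x. v \<rho> / norm \<rho> * (e x + s \<rho> x)) \<longlongrightarrow> v \<rho> / norm \<rho> * (0 + 0)) at_top"
      by (intro tendsto_intros e_lim)
    then show "(r \<rho> \<longlongrightarrow> 0) at_top"
      using eventually_mono[OF eventually_ge_at_top[of 2] r_le[OF \<rho>]]
      by (intro Lim_null_comparison[of "r \<rho>" "\<lambda>x. v \<rho> / norm \<rho> * (e x + s \<rho> x)"]) auto
  qed
  moreover have "\<forall>\<^sub>F x in at_top. (\<Sum>\<^sub>\<infinity>\<rho>\<in>A. r \<rho> x) =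
      of_real (ln x / x powr b) * (\<Sum>\<^sub>\<infinity>\<rho>\<in>A. of_real (v \<rho>) * f_rho \<rho> x) -
      (\<Sum>\<rho>\<in>{\<rho>\<in>A. Re \<rho> = b}. of_real (v \<rho>) * (cis (Im \<rho> * ln x) / \<rho>))"
    using eventually_ge_at_top[of 2]
  proof eventually_elim
    case (elim x)
    have top_sum: "(top' has_sum (\<Sum>\<rho>\<in>{\<rho>\<in>A. Re \<rho> = b}. top' \<rho>)) A"
      if "top' = (\<lambda>\<rho>. top \<rho> x)" for top'
      by (rule has_sum_finite_neutralI[OF fin]) (auto simp: that top_def)
    have r_sum: "(\<lambda>\<rho>. r \<rho> x) summable_on A"
    proof (rule abs_summable_summable, rule Infinite_Sum.abs_summable_on_comparison_test')
      show "(\<lambda>\<rho>. v \<rho> / norm \<rho> * (e x + 1)) summable_on A"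
        by (rule summable_on_cmult_left[OF sum])
      fix \<rho> assume \<rho>: "\<rho> \<in> A"
      have "v \<rho> / norm \<rho> * (e x + s \<rho> x) \<le> v \<rho> / norm \<rho> * (e x + 1)"
        using s_le[OF \<rho>] elim v[OF \<rho>] by (intro mult_left_mono) auto
      then show "norm (r \<rho> x) \<le> v \<rho> / norm \<rho> * (e x + 1)"
        using r_le[OF \<rho> elim] by simp
    qed
    have "(\<Sum>\<^sub>\<infinity>\<rho>\<in>A. r \<rho> x) + (\<Sum>\<^sub>\<infinity>\<rho>\<in>A. top \<rho> x) = (\<Sum>\<^sub>\<infinity>\<rho>\<in>A. r \<rho> x + top \<rho> x)"
      using r_sum has_sum_imp_summable[OF top_sum[OF refl]] by (rule infsum_add[symmetric])
    also have "\<dots> = of_real (ln x / x powr b) * (\<Sum>\<^sub>\<infinity>\<rho>\<in>A. of_real (v \<rho>) * f_rho \<rho> x)"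
      by (simp only: r_def diff_add_cancel infsum_cmult_right')
    finally show ?case
      using infsumI[OF top_sum[OF refl]] by (simp add: top_def algebra_simps)
  qed
  ultimately show ?thesis by (rule Lim_transform_eventually)
qed

section \<open>Dirichlet characters\<close>

lemma residues_of_nat: "q \<ge> 2 \<Longrightarrow> residues (int q)"
  by (simp add: residues_def)

lemma carrier_unit_grp:
  assumes "q \<ge> 2"
  shows "carrier (unit_grp q) = {a. 0 < a \<and> a < int q \<and> coprime a (int q)}"
  using residues.res_units_eq[OF residues_of_nat[OF assms]]
  by (simp add: unit_grp_def units_of_carrier)

lemma
  assumes "q \<ge> 2" "a \<in> carrier (unit_grp q)"
  shows inv_unit_grp_closed: "inv\<^bsub>unit_grp q\<^esub> a \<in> carrier (unit_grp q)"
    and inv_unit_grp_cong: "[a * inv\<^bsub>unit_grp q\<^esub> a = 1] (mod int q)"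
proof -
  interpret residues "int q" "residue_ring (int q)"
    by (rule residues_of_nat[OF assms(1)])
  interpret G: group "unit_grp q"
    unfolding unit_grp_def by (rule units_group)
  show "inv\<^bsub>unit_grp q\<^esub> a \<in> carrier (unit_grp q)"
    using assms(2) by (rule G.inv_closed)
  have "a \<otimes>\<^bsub>unit_grp q\<^esub> inv\<^bsub>unit_grp q\<^esub> a = \<one>\<^bsub>unit_grp q\<^esub>"
    using assms(2) by (rule G.r_inv)
  then have "a * inv\<^bsub>unit_grp q\<^esub> a mod int q = 1"
    by (simp add: unit_grp_def units_of_mult units_of_one res_mult_eq res_one_eq)
  then show "[a * inv\<^bsub>unit_grp q\<^esub> a = 1] (mod int q)"
    using assms(1) by (simp add: cong_def)
qed

context
  fixes q :: nat and \<psi> :: "int \<Rightarrow> complex"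
  assumes character: "dirichlet_character q \<psi>"
begin

lemma character_mult: "\<psi> (m * n) = \<psi> m * \<psi> n"
  using character by (simp add: dirichlet_character_def)

lemma character_eq_0_iff: "\<psi> m = 0 \<longleftrightarrow> \<not> coprime m (int q)"
  using character by (auto simp: dirichlet_character_def)

lemma character_1: "\<psi> 1 = 1"
  using character_mult[of 1 1] character_eq_0_iff[of 1] by simp

lemma character_power: "\<psi> (m ^ k) = \<psi> m ^ k"
  by (induction k) (simp_all add: character_1 character_mult)

lemma character_cong:
  assumes "[m = n] (mod int q)"
  shows "\<psi> m = \<psi> n"
proof -
  have step: "\<psi> (m + int q) = \<psi> m" for m
    using character by (simp add: dirichlet_character_def)
  have up: "\<psi> (m + int k * int q) = \<psi> m" for m k
  proof (induction k)
    case (Suc k)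
    then show ?case using step[of "m + int k * int q"] by (simp add: algebra_simps)
  qed simp
  have "\<psi> (m + k * int q) = \<psi> m" for m k
    using up[of m "nat k"] up[of "m + k * int q" "nat (- k)"]
    by (cases "k \<ge> 0") (simp_all add: algebra_simps)
  moreover obtain k where "n = m + k * int q"
    using assms by (auto simp: cong_iff_lin mult.commute)
  ultimately show ?thesis by metis
qed

lemma character_root_of_unity:
  assumes "q \<ge> 2" "coprime m (int q)"
  shows "\<psi> m ^ totient q = 1"
proof -
  have "[m ^ totient q = 1] (mod int q)"
    using residues.euler_theorem[OF residues_of_nat[OF assms(1)] assms(2)] by simp
  then show ?thesis
    using character_cong character_power character_1 by metis
qed

lemma norm_character:
  assumes "q \<ge> 2" "coprime m (int q)"
  shows "norm (\<psi> m) = 1"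
proof -
  have "norm (\<psi> m) ^ totient q = 1 ^ totient q"
    using character_root_of_unity[OF assms] by (simp flip: norm_power)
  then show ?thesis
    using assms(1) power_eq_imp_eq_base[of "norm (\<psi> m)" "totient q" 1] by simp
qed

lemma character_inv:
  assumes "q \<ge> 2" "a \<in> carrier (unit_grp q)"
  shows "\<psi> (inv\<^bsub>unit_grp q\<^esub> a) = cnj (\<psi> a)"
proof -
  have a: "coprime a (int q)" using assms by (simp add: carrier_unit_grp)
  have "\<psi> a * \<psi> (inv\<^bsub>unit_grp q\<^esub> a) = 1"
    using character_cong[OF inv_unit_grp_cong[OF assms]] by (simp add: character_mult character_1)
  moreover have "\<psi> a * cnj (\<psi> a) = 1"
    using norm_character[OF assms(1) a] by (simp add: complex_norm_square[symmetric])
  moreover have "\<psi> a \<noteq> 0" using a by (simp add: character_eq_0_iff)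
  ultimately show ?thesis by (metis mult_left_cancel)
qed

end

text \<open>
  A character is determined by its values on one period, and these are zero or have
  \<open>totient q\<close>-th power \<open>1\<close>.
\<close>

lemma finite_dirichlet_characters:
  assumes "q \<ge> 2"
  shows "finite {\<psi>. dirichlet_character q \<psi>}"
proof (rule inj_on_finite)
  let ?V = "insert 0 {z::complex. z ^ totient q = 1}"
  show "inj_on (\<lambda>\<psi>. restrict \<psi> {0..<int q}) {\<psi>. dirichlet_character q \<psi>}"
  proof (rule inj_onI, rule ext)
    fix \<psi> \<psi>' m
    assume *: "\<psi> \<in> {\<psi>. dirichlet_character q \<psi>}" "\<psi>' \<in> {\<psi>. dirichlet_character q \<psi>}"
      and eq: "restrict \<psi> {0..<int q} = restrict \<psi>' {0..<int q}"
    have "[m = m mod int q] (mod int q)" by (simp add: cong_def)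
    moreover have "m mod int q \<in> {0..<int q}" using assms by simp
    ultimately show "\<psi> m = \<psi>' m"
      using * character_cong fun_cong[OF eq, of "m mod int q"] by (metis mem_Collect_eq restrict_apply')
  qed
  show "(\<lambda>\<psi>. restrict \<psi> {0..<int q}) ` {\<psi>. dirichlet_character q \<psi>} \<subseteq> {0..<int q} \<rightarrow>\<^sub>E ?V"
    using character_root_of_unity[OF _ assms] character_eq_0_iff by fastforce
  show "finite ({0..<int q} \<rightarrow>\<^sub>E ?V)"
    using assms by (intro finite_PiE) (auto intro!: finite_roots_unity simp: Suc_le_eq)
qed

section \<open>The race between 1 and a pair of inverse classes\<close>

lemma finite_nonprincipal_characters: "q \<ge> 2 \<Longrightarrow> finite (nonprincipal_characters q)"
  using finite_dirichlet_characters by (simp add: nonprincipal_characters_def)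

context
  fixes q :: nat and B :: zero_system
  assumes q: "q \<ge> 2" and sys: "is_system q B"
begin

lemma mem_elems_iff_multip_pos:
  assumes "\<psi> \<in> nonprincipal_characters q"
  shows "\<rho> \<in> elems B \<psi> \<longleftrightarrow> multip B \<rho> \<psi> > 0"
  using sys assms by (auto simp: is_system_def elems_def multip_def card_gt_0_iff)

lemma Re_elems_bounds:
  assumes "\<psi> \<in> nonprincipal_characters q" "\<rho> \<in> elems B \<psi>"
  shows "1 / 2 < Re \<rho>" "Re \<rho> \<le> 1" "real_of_ereal (R_minus q B) \<le> Re \<rho>"
proof -
  have mem: "\<rho> \<in> (\<Union>\<psi>\<in>nonprincipal_characters q. elems B \<psi>)" using assms by blast
  have R: "1 / 2 < R_minus q B" "R_minus q B \<le> R_plus q B" "R_plus q B \<le> 1"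
    using sys by (auto simp: is_system_def)
  have lo: "R_minus q B \<le> ereal (Re \<rho>)" unfolding R_minus_def by (rule INF_lower[OF mem])
  have "ereal (Re \<rho>) \<le> R_plus q B" unfolding R_plus_def by (rule SUP_upper[OF mem])
  then have "ereal (Re \<rho>) \<le> 1" using R(3) by (rule order_trans)
  then show "Re \<rho> \<le> 1" by (simp add: one_ereal_def)
  have "R_minus q B \<le> 1" using R(2,3) by (rule order_trans)
  moreover have half: "(1 / 2 :: ereal) = ereal (1 / 2)"
    by (simp add: one_ereal_def numeral_eq_ereal)
  ultimately obtain \<beta> where \<beta>: "R_minus q B = ereal \<beta>"
    using R(1) by (cases "R_minus q B") auto
  show "1 / 2 < Re \<rho>" "real_of_ereal (R_minus q B) \<le> Re \<rho>"
    using R(1) lo unfolding \<beta> half by auto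
qed

lemma nonprincipal_character_Re:
  assumes "\<psi> \<in> nonprincipal_characters q" "a \<in> carrier (unit_grp q)"
  shows "Re (\<psi> a) \<le> 1" "Re (\<psi> a) = 1 \<longleftrightarrow> \<psi> a = 1"
proof -
  have "norm (\<psi> a) = 1"
    using norm_character[of q \<psi> a] assms q by (simp add: carrier_unit_grp nonprincipal_characters_def)
  then have *: "(Re (\<psi> a))\<^sup>2 + (Im (\<psi> a))\<^sup>2 = 1" by (simp add: cmod_def)
  show "Re (\<psi> a) \<le> 1" using complex_Re_le_cmod[of "\<psi> a"] \<open>norm (\<psi> a) = 1\<close> by simp
  show "Re (\<psi> a) = 1 \<longleftrightarrow> \<psi> a = 1" using * by (auto simp: complex_eq_iff)
qed

text \<open>
  The real part of every term of \<open>g_fun q B \<rho> a 1\<close> is \<open>multip B \<rho> \<psi> * (Re (\<psi> a) - 1) \<le> 0\<close>, so contributions of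
  different characters cannot cancel.
\<close>

lemma g_fun_1_nonzero_iff:
  assumes a: "a \<in> carrier (unit_grp q)"
  shows "g_fun q B \<rho> a 1 \<noteq> 0 \<longleftrightarrow> (\<exists>\<psi>\<in>nonprincipal_characters q. \<rho> \<in> elems B \<psi> \<and> \<psi> a \<noteq> 1)"
proof -
  have one: "\<psi> 1 = 1" if "\<psi> \<in> nonprincipal_characters q" for \<psi>
    using that character_1 by (auto simp: nonprincipal_characters_def)
  have g: "g_fun q B \<rho> a 1 = (\<Sum>\<psi>\<in>nonprincipal_characters q. of_nat (multip B \<rho> \<psi>) * (\<psi> a - 1))"
    unfolding g_fun_def by (rule sum.cong) (simp_all add: one)
  show ?thesis
  proof
    assume "g_fun q B \<rho> a 1 \<noteq> 0"
    then obtain \<psi> where "\<psi> \<in> nonprincipal_characters q" "of_nat (multip B \<rho> \<psi>) * (\<psi> a - 1) \<noteq> 0"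
      unfolding g by (meson sum.neutral)
    then show "\<exists>\<psi>\<in>nonprincipal_characters q. \<rho> \<in> elems B \<psi> \<and> \<psi> a \<noteq> 1"
      by (intro bexI[of _ \<psi>]) (auto simp: mem_elems_iff_multip_pos)
  next
    assume "\<exists>\<psi>\<in>nonprincipal_characters q. \<rho> \<in> elems B \<psi> \<and> \<psi> a \<noteq> 1"
    then obtain \<psi> where \<psi>: "\<psi> \<in> nonprincipal_characters q" "\<rho> \<in> elems B \<psi>" "\<psi> a \<noteq> 1" by blast
    have "0 < (\<Sum>\<psi>\<in>nonprincipal_characters q. real (multip B \<rho> \<psi>) * (1 - Re (\<psi> a)))"
    proof (rule sum_pos2[OF finite_nonprincipal_characters[OF q] \<psi>(1)])
      have "Re (\<psi> a) < 1" using nonprincipal_character_Re[OF \<psi>(1) a] \<psi>(3) by linarith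
      then show "0 < real (multip B \<rho> \<psi>) * (1 - Re (\<psi> a))"
        using \<psi>(2) unfolding mem_elems_iff_multip_pos[OF \<psi>(1)] by simp
    qed (use nonprincipal_character_Re(1)[OF _ a] in auto)
    also have "\<dots> = - Re (g_fun q B \<rho> a 1)"
      unfolding g Re_sum sum_negf[symmetric] by (rule sum.cong) (simp_all add: algebra_simps)
    finally show "g_fun q B \<rho> a 1 \<noteq> 0" by auto
  qed
qed

text \<open>
  Since \<open>\<psi> (inv a) = cnj (\<psi> a)\<close>, averaging \<open>cnj (\<psi> a)\<close> and \<open>cnj (\<psi> (inv a))\<close> gives the real number \<open>Re (\<psi> a)\<close>,
  which can be pulled out of the real part.
\<close>

lemma P_fun_1_minus_mean:
  assumes a: "a \<in> carrier (unit_grp q)"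
  shows "P_fun q B 1 x - (P_fun q B a x + P_fun q B (inv\<^bsub>unit_grp q\<^esub> a) x) / 2 =
    - 2 / real (totient q) * (\<Sum>\<psi>\<in>nonprincipal_characters q. (1 - Re (\<psi> a)) *
        Re (\<Sum>\<^sub>\<infinity>\<rho>\<in>elems B \<psi>. of_real (weight \<rho>) * of_nat (multip B \<rho> \<psi>) * f_rho \<rho> x))"
proof -
  define S where "S = (\<lambda>\<psi>. \<Sum>\<^sub>\<infinity>\<rho>\<in>elems B \<psi>. of_real (weight \<rho>) * of_nat (multip B \<rho> \<psi>) * f_rho \<rho> x)"
  define U where "U = (\<lambda>b. \<Sum>\<psi>\<in>nonprincipal_characters q. cnj (\<psi> b) * S \<psi>)"
  have P: "P_fun q B b x = - 2 / real (totient q) * Re (U b) + real (prime_count x) / real (totient q)" for b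
    by (simp add: P_fun_def U_def S_def)
  have "Re (U 1) - (Re (U a) + Re (U (inv\<^bsub>unit_grp q\<^esub> a))) / 2 =
        (\<Sum>\<psi>\<in>nonprincipal_characters q. (1 - Re (\<psi> a)) * Re (S \<psi>))"
    unfolding U_def Re_sum sum.distrib[symmetric] sum_divide_distrib sum_subtractf[symmetric]
  proof (rule sum.cong[OF refl])
    fix \<psi> assume "\<psi> \<in> nonprincipal_characters q"
    then have \<psi>: "dirichlet_character q \<psi>" by (simp add: nonprincipal_characters_def)
    show "Re (cnj (\<psi> 1) * S \<psi>) - (Re (cnj (\<psi> a) * S \<psi>) + Re (cnj (\<psi> (inv\<^bsub>unit_grp q\<^esub> a)) * S \<psi>)) / 2
        = (1 - Re (\<psi> a)) * Re (S \<psi>)"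
      by (simp add: character_1[OF \<psi>] character_inv[OF \<psi> q a] algebra_simps)
  qed
  moreover have "P_fun q B 1 x - (P_fun q B a x + P_fun q B (inv\<^bsub>unit_grp q\<^esub> a) x) / 2 =
      - 2 / real (totient q) * (Re (U 1) - (Re (U a) + Re (U (inv\<^bsub>unit_grp q\<^esub> a))) / 2)"
    unfolding P add_divide_distrib right_diff_distrib distrib_left by simp
  ultimately show ?thesis by (simp only: S_def)
qed

text \<open>
  Similarity is measured on the scale of \<open>R_minus q B\<close>, which is at most the scale \<open>b\<close> of the
  main term; so errors of similar families vanish after the normalisation used for the main term.
\<close>

lemma similar_tendsto_0:
  assumes F: "similar q (real_of_ereal (R_minus q B)) F P" and c: "c \<in> carrier (unit_grp q)"
    and b: "real_of_ereal (R_minus q B) \<le> b"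
  shows "((\<lambda>x. ln x / x powr b * (F c x - P c x)) \<longlongrightarrow> 0) at_top"
proof -
  let ?\<beta> = "real_of_ereal (R_minus q B)"
  have "((\<lambda>x. \<bar>F c x - P c x\<bar> / (x powr ?\<beta> / ln x)) \<longlongrightarrow> 0) at_top"
    using F c unfolding similar_def by (intro smalloD_tendsto) auto
  moreover have "\<forall>\<^sub>F x in at_top. norm (ln x / x powr b * (F c x - P c x))
      \<le> \<bar>F c x - P c x\<bar> / (x powr ?\<beta> / ln x)"
    using eventually_gt_at_top[of 1]
  proof eventually_elim
    case (elim x)
    have "ln x / x powr b \<le> ln x / x powr ?\<beta>"
      using elim b by (intro divide_left_mono powr_mono) auto
    then have "ln x / x powr b * \<bar>F c x - P c x\<bar> \<le> ln x / x powr ?\<beta> * \<bar>F c x - P c x\<bar>"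
      by (rule mult_right_mono) simp
    moreover have "norm (ln x / x powr b * (F c x - P c x)) = ln x / x powr b * \<bar>F c x - P c x\<bar>"
      using elim by (simp add: abs_mult)
    moreover have "ln x / x powr ?\<beta> * \<bar>F c x - P c x\<bar> = \<bar>F c x - P c x\<bar> / (x powr ?\<beta> / ln x)"
      by simp
    ultimately show ?case by linarith
  qed
  ultimately show ?thesis by (rule Lim_null_comparison[rotated])
qed

text \<open>
  The asymptotics apply to each character separately; a character with \<open>\<psi> a = 1\<close> has coefficient
  \<open>c \<psi> = 0\<close> and drops out, and for all others every element of \<open>elems B \<psi>\<close> has \<open>g_fun\<close> nonzero, hence real
  part at most \<open>b\<close>, with equality only on \<open>z_set q B a 1\<close>. After normalisation the difference of the
  two sides is at least \<open>2 / totient q * \<kappa> * W\<close> up to \<open>o(1)\<close>, where the total mass \<open>W\<close> of the leading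
  terms is positive because \<open>z_set q B a 1\<close> is nonempty.
\<close>

lemma eventually_mean_less_at_negative_phases:
  assumes a: "a \<in> carrier (unit_grp q)" and ne: "z_set q B a 1 \<noteq> {}" and fin: "finite (z_set q B a 1)"
    and \<kappa>: "\<kappa> > 0" and F: "similar q (real_of_ereal (R_minus q B)) F (P_fun q B)"
  shows "\<forall>\<^sub>F x in at_top. (\<forall>\<rho>\<in>z_set q B a 1. Re (cis (Im \<rho> * ln x) / \<rho>) \<le> - \<kappa>) \<longrightarrow>
           (F a x + F (inv\<^bsub>unit_grp q\<^esub> a) x) / 2 < F 1 x"
proof -
  define NP where "NP = nonprincipal_characters q"
  define a' where "a' = inv\<^bsub>unit_grp q\<^esub> a"
  have finNP: "finite NP" unfolding NP_def by (rule finite_nonprincipal_characters[OF q])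
  obtain \<rho>0 \<psi>1 where \<rho>0: "\<rho>0 \<in> z_set q B a 1" "\<psi>1 \<in> NP" "\<rho>0 \<in> elems B \<psi>1"
      "g_fun q B \<rho>0 a 1 \<noteq> 0" "ereal (Re \<rho>0) = beta_sup q B a 1"
    using ne unfolding z_set_def NP_def by blast
  define b where "b = Re \<rho>0"
  have b: "beta_sup q B a 1 = ereal b" using \<rho>0(5) by (simp add: b_def)
  obtain \<psi>0 where \<psi>0: "\<psi>0 \<in> NP" "\<rho>0 \<in> elems B \<psi>0" "\<psi>0 a \<noteq> 1"
    using \<rho>0(4) g_fun_1_nonzero_iff[OF a] by (auto simp: NP_def)
  define c where "c = (\<lambda>\<psi>::int \<Rightarrow> complex. 1 - Re (\<psi> a))"
  have c_nonneg: "c \<psi> \<ge> 0" and c_0: "c \<psi> = 0 \<longleftrightarrow> \<psi> a = 1" if "\<psi> \<in> NP" for \<psi>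
    using nonprincipal_character_Re[OF that[unfolded NP_def] a] by (auto simp: c_def)
  define Z where "Z = (\<lambda>\<psi>. {\<rho>\<in>elems B \<psi>. Re \<rho> = b})"
  have Re_le: "Re \<rho> \<le> b" if "\<psi> \<in> NP" "c \<psi> \<noteq> 0" "\<rho> \<in> elems B \<psi>" for \<psi> \<rho>
  proof -
    have "ereal (Re \<rho>) \<le> beta_sup q B a 1"
      unfolding beta_sup_def
      using that c_0 g_fun_1_nonzero_iff[OF a] by (intro SUP_upper) (auto simp: NP_def)
    then show ?thesis by (simp add: b)
  qed
  have Z_sub: "Z \<psi> \<subseteq> z_set q B a 1" if "\<psi> \<in> NP" "c \<psi> \<noteq> 0" for \<psi>
    using that c_0 g_fun_1_nonzero_iff[OF a] unfolding Z_def z_set_def b NP_def by auto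
  define v where "v = (\<lambda>\<psi> \<rho>. weight \<rho> * real (multip B \<rho> \<psi>))"
  have v_nonneg: "v \<psi> \<rho> \<ge> 0" for \<psi> \<rho> by (simp add: v_def weight_def)
  define S where "S = (\<lambda>\<psi> x. \<Sum>\<^sub>\<infinity>\<rho>\<in>elems B \<psi>. of_real (weight \<rho>) * of_nat (multip B \<rho> \<psi>) * f_rho \<rho> x)"
  define L where "L = (\<lambda>x. ln x / x powr b)"
  define M where "M = (\<lambda>\<psi> x. \<Sum>\<rho>\<in>Z \<psi>. v \<psi> \<rho> * Re (cis (Im \<rho> * ln x) / \<rho>))"
  define T where "T = (\<lambda>x. \<Sum>\<psi>\<in>NP. c \<psi> * (L x * Re (S \<psi> x) - M \<psi> x))"
  have T_lim: "(T \<longlongrightarrow> 0) at_top"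
    unfolding T_def
  proof (rule tendsto_null_sum)
    fix \<psi> assume \<psi>: "\<psi> \<in> NP"
    show "((\<lambda>x. c \<psi> * (L x * Re (S \<psi> x) - M \<psi> x)) \<longlongrightarrow> 0) at_top"
    proof (cases "c \<psi> = 0")
      case False
      have "((\<lambda>x. of_real (ln x / x powr b) * (\<Sum>\<^sub>\<infinity>\<rho>\<in>elems B \<psi>. of_real (v \<psi> \<rho>) * f_rho \<rho> x) -
            (\<Sum>\<rho>\<in>{\<rho>\<in>elems B \<psi>. Re \<rho> = b}. of_real (v \<psi> \<rho>) * (cis (Im \<rho> * ln x) / \<rho>))) \<longlongrightarrow> 0) at_top"
      proof (rule f_rho_sum_asymptotics)
        have "(\<lambda>\<rho>. real (multip B \<rho> \<psi>) / norm \<rho>) summable_on elems B \<psi>"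
          using sys \<psi> by (simp add: is_system_def NP_def)
        then show "(\<lambda>\<rho>. v \<psi> \<rho> / norm \<rho>) summable_on elems B \<psi>"
        proof (rule summable_on_comparison_test)
          fix \<rho>
          have "v \<psi> \<rho> \<le> real (multip B \<rho> \<psi>)" by (simp add: v_def weight_def)
          then show "v \<psi> \<rho> / norm \<rho> \<le> real (multip B \<rho> \<psi>) / norm \<rho>"
            by (rule divide_right_mono) simp
          show "0 \<le> v \<psi> \<rho> / norm \<rho>" using v_nonneg by simp
        qed
        show "1 / 4 \<le> Re \<rho> \<and> Re \<rho> \<le> b" if "\<rho> \<in> elems B \<psi>" for \<rho>
          using Re_elems_bounds(1)[OF \<psi>[unfolded NP_def] that] Re_le[OF \<psi> False that] by simp
        show "finite {\<rho> \<in> elems B \<psi>. Re \<rho> = b}"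
          using finite_subset[OF Z_sub[OF \<psi> False] fin] by (simp add: Z_def)
      qed (rule v_nonneg)
      then have "((\<lambda>x. c \<psi> * Re (of_real (L x) * S \<psi> x -
            (\<Sum>\<rho>\<in>Z \<psi>. of_real (v \<psi> \<rho>) * (cis (Im \<rho> * ln x) / \<rho>)))) \<longlongrightarrow> c \<psi> * Re 0) at_top"
        unfolding L_def S_def Z_def by (intro tendsto_intros) (simp add: v_def)
      moreover have "Re (of_real (L x) * S \<psi> x -
            (\<Sum>\<rho>\<in>Z \<psi>. of_real (v \<psi> \<rho>) * (cis (Im \<rho> * ln x) / \<rho>))) = L x * Re (S \<psi> x) - M \<psi> x" for x
        by (simp only: M_def Re_sum minus_complex.sel times_complex.sel Re_complex_of_real
              Im_complex_of_real mult_zero_left diff_zero)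
      ultimately show ?thesis by simp
    qed simp
  qed
  define W where "W = (\<Sum>\<psi>\<in>NP. c \<psi> * (\<Sum>\<rho>\<in>Z \<psi>. v \<psi> \<rho>))"
  have W_pos: "W > 0"
    unfolding W_def
  proof (rule sum_pos2[OF finNP \<psi>0(1)])
    have "finite (Z \<psi>0)" using finite_subset[OF Z_sub[OF \<psi>0(1)] fin] c_0[OF \<psi>0(1)] \<psi>0(3) by simp
    then have "(\<Sum>\<rho>\<in>Z \<psi>0. v \<psi>0 \<rho>) > 0"
    proof (rule sum_pos2)
      show "\<rho>0 \<in> Z \<psi>0" using \<psi>0(2) by (simp add: Z_def b_def)
      show "v \<psi>0 \<rho>0 > 0"
        using \<psi>0 mem_elems_iff_multip_pos by (simp add: v_def weight_def NP_def)
    qed (rule v_nonneg)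
    then show "0 < c \<psi>0 * (\<Sum>\<rho>\<in>Z \<psi>0. v \<psi>0 \<rho>)"
      using c_nonneg[OF \<psi>0(1)] c_0[OF \<psi>0(1)] \<psi>0(3) by (intro mult_pos_pos) auto
  qed (use c_nonneg v_nonneg in \<open>auto intro!: mult_nonneg_nonneg sum_nonneg\<close>)
  have M_le: "(\<Sum>\<psi>\<in>NP. c \<psi> * M \<psi> x) \<le> - \<kappa> * W"
    if x: "\<forall>\<rho>\<in>z_set q B a 1. Re (cis (Im \<rho> * ln x) / \<rho>) \<le> - \<kappa>" for x
  proof -
    have "c \<psi> * M \<psi> x \<le> c \<psi> * (\<Sum>\<rho>\<in>Z \<psi>. v \<psi> \<rho> * - \<kappa>)" if \<psi>: "\<psi> \<in> NP" for \<psi>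
    proof (cases "c \<psi> = 0")
      case False
      show ?thesis unfolding M_def
        using Z_sub[OF \<psi> False] x by (intro mult_left_mono sum_mono v_nonneg c_nonneg[OF \<psi>]) auto
    qed simp
    then have "(\<Sum>\<psi>\<in>NP. c \<psi> * M \<psi> x) \<le> (\<Sum>\<psi>\<in>NP. c \<psi> * (\<Sum>\<rho>\<in>Z \<psi>. v \<psi> \<rho> * - \<kappa>))"
      by (rule sum_mono)
    also have "\<dots> = - \<kappa> * W"
      by (simp add: W_def sum_distrib_left sum_distrib_right sum_negf mult_ac)
    finally show ?thesis .
  qed
  define E where "E = (\<lambda>y x. L x * (F y x - P_fun q B y x))"
  have b_ge: "real_of_ereal (R_minus q B) \<le> b"
    using Re_elems_bounds(3) \<psi>0 by (simp add: b_def NP_def)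
  have E_lim: "(E y \<longlongrightarrow> 0) at_top" if "y \<in> carrier (unit_grp q)" for y
    unfolding E_def L_def by (rule similar_tendsto_0[OF F that b_ge])
  define K where "K = 2 / real (totient q)"
  have K: "K > 0" using q by (simp add: K_def)
  have "((\<lambda>x. K * (\<kappa> * W - T x) + E 1 x - (E a x + E a' x) / 2) \<longlongrightarrow> K * (\<kappa> * W - 0) + 0 - (0 + 0) / 2) at_top"
    using q a inv_unit_grp_closed[OF q a]
    by (intro tendsto_intros T_lim E_lim) (auto simp: carrier_unit_grp a'_def)
  moreover have "K * (\<kappa> * W - 0) + 0 - (0 + 0) / 2 > 0" using K \<kappa> W_pos by simp
  ultimately have "\<forall>\<^sub>F x in at_top. K * (\<kappa> * W - T x) + E 1 x - (E a x + E a' x) / 2 > 0"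
    by (rule order_tendstoD(1))
  then show ?thesis
    using eventually_gt_at_top[of 1]
  proof eventually_elim
    case (elim x)
    show ?case
    proof
      assume x: "\<forall>\<rho>\<in>z_set q B a 1. Re (cis (Im \<rho> * ln x) / \<rho>) \<le> - \<kappa>"
      have Lpos: "L x > 0" using elim by (simp add: L_def)
      have "T x = L x * (\<Sum>\<psi>\<in>NP. c \<psi> * Re (S \<psi> x)) - (\<Sum>\<psi>\<in>NP. c \<psi> * M \<psi> x)"
        by (simp add: T_def right_diff_distrib sum_subtractf sum_distrib_left mult_ac)
      then have "L x * (\<Sum>\<psi>\<in>NP. c \<psi> * Re (S \<psi> x)) \<le> T x - \<kappa> * W" using M_le[OF x] by simp
      then have "K * (\<kappa> * W - T x) \<le> K * - (L x * (\<Sum>\<psi>\<in>NP. c \<psi> * Re (S \<psi> x)))"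
        using K by (intro mult_left_mono) auto
      also have "\<dots> = L x * (P_fun q B 1 x - (P_fun q B a x + P_fun q B a' x) / 2)"
        unfolding a'_def P_fun_1_minus_mean[OF a] by (simp add: NP_def c_def S_def K_def)
      finally have "0 < L x * (P_fun q B 1 x - (P_fun q B a x + P_fun q B a' x) / 2)
          + E 1 x - (E a x + E a' x) / 2" using elim(1) by linarith
      also have "\<dots> = L x * (F 1 x - (F a x + F a' x) / 2)"
        by (simp add: E_def field_simps)
      finally have "0 < F 1 x - (F a x + F a' x) / 2" using Lpos by (simp add: zero_less_mult_iff)
      then show "(F a x + F (inv\<^bsub>unit_grp q\<^esub> a) x) / 2 < F 1 x" by (simp add: a'_def)
    qed
  qed
qed

text \<open>
  The set \<open>D\<close> is finite, so there is one threshold beyond which the previous lemma holds for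
  all \<open>a \<in> D\<close>; a time beyond it at which all the real parts are at most \<open>-\<kappa>\<close> contradicts
  the statement.
\<close>

lemma barrier_of_recurrent_negative_phases:
  assumes D: "D \<subseteq> carrier (unit_grp q)"
    and ne: "\<And>a. a \<in> D \<Longrightarrow> z_set q B a 1 \<noteq> {}"
    and fin: "finite (\<Union>a\<in>D. z_set q B a 1)"
    and \<kappa>: "\<kappa> > 0"
    and phases: "\<And>X. \<exists>u\<ge>X. \<forall>\<rho>\<in>(\<Union>a\<in>D. z_set q B a 1). Re (cis (Im \<rho> * u) / \<rho>) \<le> - \<kappa>"
  shows "is_barrier q B
           (\<lambda>F. \<forall>\<^sub>F x in at_top. \<exists>a\<in>D. F 1 x \<le> (F a x + F (inv\<^bsub>unit_grp q\<^esub> a) x) / 2)"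
  unfolding is_barrier_def
proof (intro allI impI notI)
  fix F
  assume F: "similar q (real_of_ereal (R_minus q B)) F (P_fun q B)"
    and bad: "\<forall>\<^sub>F x in at_top. \<exists>a\<in>D. F 1 x \<le> (F a x + F (inv\<^bsub>unit_grp q\<^esub> a) x) / 2"
  have "carrier (unit_grp q) \<subseteq> {0..int q}" using q by (auto simp: carrier_unit_grp)
  then have "finite D" using D finite_subset[of D "{0..int q}"] by auto
  then have "\<forall>\<^sub>F x in at_top. \<forall>a\<in>D. (\<forall>\<rho>\<in>z_set q B a 1. Re (cis (Im \<rho> * ln x) / \<rho>) \<le> - \<kappa>) \<longrightarrow>
           (F a x + F (inv\<^bsub>unit_grp q\<^esub> a) x) / 2 < F 1 x"
  proof (rule eventually_ball_finite, intro ballI)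
    fix a assume a: "a \<in> D"
    have "finite (z_set q B a 1)" using a by (intro finite_subset[OF _ fin]) blast
    then show "\<forall>\<^sub>F x in at_top. (\<forall>\<rho>\<in>z_set q B a 1. Re (cis (Im \<rho> * ln x) / \<rho>) \<le> - \<kappa>) \<longrightarrow>
           (F a x + F (inv\<^bsub>unit_grp q\<^esub> a) x) / 2 < F 1 x"
      using eventually_mean_less_at_negative_phases[OF _ ne _ \<kappa> F] a D by blast
  qed
  then have "\<forall>\<^sub>F x in at_top. \<not> (\<forall>\<rho>\<in>(\<Union>a\<in>D. z_set q B a 1). Re (cis (Im \<rho> * ln x) / \<rho>) \<le> - \<kappa>)"
    using bad by eventually_elim (auto simp: not_le[symmetric])
  then obtain x0 where x0: "\<And>x. x \<ge> x0 \<Longrightarrow>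
      \<not> (\<forall>\<rho>\<in>(\<Union>a\<in>D. z_set q B a 1). Re (cis (Im \<rho> * ln x) / \<rho>) \<le> - \<kappa>)"
    unfolding eventually_at_top_linorder by blast
  obtain u where u: "u \<ge> x0" "\<forall>\<rho>\<in>(\<Union>a\<in>D. z_set q B a 1). Re (cis (Im \<rho> * u) / \<rho>) \<le> - \<kappa>"
    using phases by blast
  have "exp u \<ge> x0" using u(1) exp_ge_add_one_self[of u] by linarith
  then show False using x0[of "exp u"] u(2) by simp
qed

end

text \<open>
  The phases depend on the leading \<open>\<rho>\<close> only through their imaginary parts, of which there are at
  most \<open>n\<close>. So the bound for \<open>n\<close> frequencies gives a threshold valid for all \<open>q\<close>, \<open>D\<close> and \<open>B\<close>.
\<close>

theorem theorem3p6:
  shows "\<exists>\<tau> :: nat \<Rightarrow> real. computable_real_seq \<tau> \<and>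
    (\<forall>n\<ge>1. \<forall>(q::nat)\<ge>3. \<forall>(D::int set) (B::zero_system).
       D \<subseteq> carrier (unit_grp q) \<and> 1 \<notin> D \<and> is_system q B \<and>
       (\<forall>a\<in>D. z_set q B a 1 \<noteq> {}) \<and>
       (\<forall>\<rho>\<in>(\<Union>a\<in>D. z_set q B a 1). Im \<rho> \<ge> \<tau> n) \<and>
       finite (\<Union>a\<in>D. z_set q B a 1) \<and> card (\<Union>a\<in>D. z_set q B a 1) \<le> n \<longrightarrow>
       is_barrier q B
         (\<lambda>F. \<forall>\<^sub>F x in at_top. \<exists>a\<in>D. F 1 x \<le> (F a x + F (inv\<^bsub>unit_grp q\<^esub> a) x) / 2))"
proof (intro exI[of _ "\<lambda>n. real (8 * phase_denom n)"] conjI allI impI)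
  show "computable_real_seq (\<lambda>n. real (8 * phase_denom n))"
    by (intro computable_real_seq_of_nat recursive_fn_mult recursive_fn_const
          recursive_fn_phase_denom recursive_fn.proj) simp
next
  fix n q :: nat and D :: "int set" and B :: zero_system
  let ?Z = "\<Union>a\<in>D. z_set q B a 1"
  assume "n \<ge> 1" "q \<ge> 3" and H: "D \<subseteq> carrier (unit_grp q) \<and> 1 \<notin> D \<and> is_system q B \<and>
       (\<forall>a\<in>D. z_set q B a 1 \<noteq> {}) \<and> (\<forall>\<rho>\<in>?Z. Im \<rho> \<ge> real (8 * phase_denom n)) \<and>
       finite ?Z \<and> card ?Z \<le> n"
  then have q: "q \<ge> 2" and sys: "is_system q B" by auto
  have "card (Im ` ?Z) \<le> n" using H card_image_le[of ?Z Im] by linarith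
  then obtain \<kappa> where \<kappa>: "\<kappa> > 0" "\<And>X. \<exists>u\<ge>X. \<forall>\<rho>. Im \<rho> \<in> Im ` ?Z \<and> 0 \<le> Re \<rho> \<and> Re \<rho> \<le> 1 \<longrightarrow>
      Re (cis (Im \<rho> * u) / \<rho>) \<le> - \<kappa>"
    using simultaneous_negative_real_parts[of "Im ` ?Z" n] H by blast
  have Re: "0 \<le> Re \<rho> \<and> Re \<rho> \<le> 1" if "\<rho> \<in> ?Z" for \<rho>
  proof -
    obtain \<psi> where "\<psi> \<in> nonprincipal_characters q" "\<rho> \<in> elems B \<psi>"
      using \<open>\<rho> \<in> ?Z\<close> by (auto simp: z_set_def)
    then show ?thesis using Re_elems_bounds(1,2)[OF q sys] by fastforce
  qed
  show "is_barrier q B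
         (\<lambda>F. \<forall>\<^sub>F x in at_top. \<exists>a\<in>D. F 1 x \<le> (F a x + F (inv\<^bsub>unit_grp q\<^esub> a) x) / 2)"
  proof (rule barrier_of_recurrent_negative_phases[OF q sys])
    show "\<exists>u\<ge>X. \<forall>\<rho>\<in>?Z. Re (cis (Im \<rho> * u) / \<rho>) \<le> - \<kappa>" for X
      using \<kappa>(2)[of X] Re by blast
  qed (use H \<kappa>(1) in auto)
qed

end
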